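(* Let $X\subseteq\mathbb C^n$ be an irreducible curve. (I) If $X$ is not contained in any hypersphere, then $\Sigma_X^\infty=\emptyset$. (II) Otherwise, let $c$ be the center of a hypersphere containing $X$, let $V$ be the smallest affine linear subspace of $\mathbb C^n$ containing $X$, and let $N\,V=\{y\in\mathbb C^n: y\cdot(v-v')=0\ \forall v,v'\in V\}$ be its normal space. Then $\Sigma_X^\infty=\{c+y:y\in N\,V\}$.
   Context: For $x,y\in\mathbb C^n$, $x\cdot y=\sum x_iy_i$ (complex bilinear). A hypersphere centered at $c$ is a set $\{x:(x-c)\cdot(x-c)=r\}$ for some $r\in\mathbb C$ ($r=0$ allowed). For $x\in X_{\mathrm{reg}}$ (smooth locus), $N_xX$ is the span of gradients at $x$ of generators of the ideal of $X$. The ED correspondence $\mathcal E_X$ is the Zariski closure of $\{(x,u):x\in X_{\mathrm{reg}},u-x\in N_xX\}$, $\mathcal E_X(u)=\{x:(x,u)\in\mathcal E_X\}$, and $\Sigma_X^\infty=\{u:\dim\mathcal E_X(u)\ge1\}$. *)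

theory Defs
  imports "HOL-Analysis.Analysis"
begin

text \<open>Polynomial functions on a space with a given set of coordinate functions C:
  the smallest set containing constants and coordinates, closed under + and *.
  Over the infinite field of complex numbers these are exactly the polynomials.\<close>

inductive_set polyfun :: "('a \<Rightarrow> complex) set \<Rightarrow> ('a \<Rightarrow> complex) set"
  for C :: "('a \<Rightarrow> complex) set" where
  pf_const: "(\<lambda>x. c) \<in> polyfun C"
| pf_coord: "f \<in> C \<Longrightarrow> f \<in> polyfun C"
| pf_add: "f \<in> polyfun C \<Longrightarrow> g \<in> polyfun C \<Longrightarrow> (\<lambda>x. f x + g x) \<in> polyfun C"
| pf_mult: "f \<in> polyfun C \<Longrightarrow> g \<in> polyfun C \<Longrightarrow> (\<lambda>x. f x * g x) \<in> polyfun C"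

definition coordsV :: "(complex^'n \<Rightarrow> complex) set" where
  "coordsV = range (\<lambda>i x. x $ i)"

definition coordsP :: "((complex^'n) \<times> (complex^'n) \<Rightarrow> complex) set" where
  "coordsP = range (\<lambda>i p. fst p $ i) \<union> range (\<lambda>i p. snd p $ i)"

definition zero_set :: "('a \<Rightarrow> complex) set \<Rightarrow> 'a set" where
  "zero_set F = {x. \<forall>f\<in>F. f x = 0}"

definition zariski_closed :: "('a \<Rightarrow> complex) set \<Rightarrow> 'a set \<Rightarrow> bool" where
  "zariski_closed C S \<longleftrightarrow> (\<exists>F. F \<subseteq> polyfun C \<and> S = zero_set F)"

definition zariski_closure :: "('a \<Rightarrow> complex) set \<Rightarrow> 'a set \<Rightarrow> 'a set" where
  "zariski_closure C S = \<Inter>{Z. zariski_closed C Z \<and> S \<subseteq> Z}"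

definition vanishing_ideal :: "('a \<Rightarrow> complex) set \<Rightarrow> 'a set \<Rightarrow> ('a \<Rightarrow> complex) set" where
  "vanishing_ideal C S = {f \<in> polyfun C. \<forall>x\<in>S. f x = 0}"

definition zariski_irreducible :: "('a \<Rightarrow> complex) set \<Rightarrow> 'a set \<Rightarrow> bool" where
  "zariski_irreducible C S \<longleftrightarrow> zariski_closed C S \<and> S \<noteq> {} \<and>
     (\<forall>A B. zariski_closed C A \<and> zariski_closed C B \<and> S = A \<union> B \<longrightarrow> S = A \<or> S = B)"

definition dim_ge :: "('a \<Rightarrow> complex) set \<Rightarrow> 'a set \<Rightarrow> nat \<Rightarrow> bool" where
  "dim_ge C S k \<longleftrightarrow> (\<exists>Z :: nat \<Rightarrow> 'a set.
      (\<forall>i\<le>k. zariski_irreducible C (Z i) \<and> Z i \<subseteq> S) \<and> (\<forall>i<k. Z i \<subset> Z (Suc i)))"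

definition alg_dim :: "('a \<Rightarrow> complex) set \<Rightarrow> 'a set \<Rightarrow> nat" where
  "alg_dim C S = (GREATEST k. dim_ge C S k)"

definition irreducible_curve :: "(complex^'n) set \<Rightarrow> bool" where
  "irreducible_curve X \<longleftrightarrow> zariski_irreducible coordsV X \<and> dim_ge coordsV X 1 \<and> \<not> dim_ge coordsV X 2"

definition partial_deriv :: "(complex^'n \<Rightarrow> complex) \<Rightarrow> 'n \<Rightarrow> complex^'n \<Rightarrow> complex" where
  "partial_deriv f i x = deriv (\<lambda>t. f (x + (\<chi> j. if j = i then t else 0))) 0"

definition gradient :: "(complex^'n \<Rightarrow> complex) \<Rightarrow> complex^'n \<Rightarrow> complex^'n" where
  "gradient f x = (\<chi> i. partial_deriv f i x)"

text \<open>N_x X: complex span of the gradients at x of the elements of the ideal of X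
  (equal, for x in X, to the span of the gradients of any generating set).\<close>
definition normal_space_at :: "(complex^'n) set \<Rightarrow> complex^'n \<Rightarrow> (complex^'n) set" where
  "normal_space_at X x = vec.span ((\<lambda>f. gradient f x) ` vanishing_ideal coordsV X)"

text \<open>Smooth locus (Jacobian criterion): points where dim N_x X = n - dim X.\<close>
definition regular_points :: "(complex^'n) set \<Rightarrow> (complex^'n) set" where
  "regular_points X = {x \<in> X. vec.dim (normal_space_at X x) = CARD('n) - alg_dim coordsV X}"

definition ED_corr :: "(complex^'n) set \<Rightarrow> ((complex^'n) \<times> (complex^'n)) set" where
  "ED_corr X = zariski_closure coordsP
     {(x, u). x \<in> regular_points X \<and> u - x \<in> normal_space_at X x}"

definition ED_fiber :: "(complex^'n) set \<Rightarrow> complex^'n \<Rightarrow> (complex^'n) set" where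
  "ED_fiber X u = {x. (x, u) \<in> ED_corr X}"

definition Sigma_inf :: "(complex^'n) set \<Rightarrow> (complex^'n) set" where
  "Sigma_inf X = {u. dim_ge coordsV (ED_fiber X u) 1}"

definition bdot :: "complex^'n \<Rightarrow> complex^'n \<Rightarrow> complex" where
  "bdot x y = (\<Sum>i\<in>UNIV. x $ i * y $ i)"

definition hypersphere :: "complex^'n \<Rightarrow> complex \<Rightarrow> (complex^'n) set" where
  "hypersphere c r = {x. bdot (x - c) (x - c) = r}"

definition complex_affine :: "(complex^'n) set \<Rightarrow> bool" where
  "complex_affine V \<longleftrightarrow> V = {} \<or> (\<exists>p W. vec.subspace W \<and> V = (\<lambda>w. p + w) ` W)"

definition complex_affine_hull :: "(complex^'n) set \<Rightarrow> (complex^'n) set" where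
  "complex_affine_hull X = \<Inter>{V. complex_affine V \<and> X \<subseteq> V}"

definition normal_space_affine :: "(complex^'n) set \<Rightarrow> (complex^'n) set" where
  "normal_space_affine V = {y. \<forall>v\<in>V. \<forall>v'\<in>V. bdot y (v - v') = 0}"

end

theory Submission
  imports Defs "HOL-Complex_Analysis.Conformal_Mappings"
begin

text \<open>
  Choose \<open>x0 \<in> X\<close> where the normal space has maximal dimension \<open>r\<close>, polynomials in the ideal whose
  gradients form a basis of it there, and complete them by linear forms to local coordinates. The
  coordinate vector fields of the linear forms, cleared of denominators, are polynomial fields
  orthogonal to all normal spaces of \<open>X\<close>, so differentiation along them preserves the ideal of \<open>X\<close>.
  Hence every element of the ideal vanishes to infinite order along the holomorphic coordinate
  arcs through \<open>x0\<close>, and these arcs lie in \<open>X\<close>. The Zariski closure of an arc is irreducible;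
  if there were two linear forms, the arc of the first would lie in a level set of the second and
  give a chain of length two. So \<open>r = n - 1\<close> and a single arc of regular points is Zariski dense
  in \<open>X\<close>.

  If \<open>u \<in> Sigma_inf X\<close>, then \<open>ED_fiber X u = X\<close>, and \<open>u - x\<close> is orthogonal to the tangent field
  at every \<open>x \<in> X\<close>; thus \<open>bdot (x - u) (x - u)\<close> is constant along the arc, hence on \<open>X\<close>.
  Conversely \<open>u - x\<close> is normal at \<open>x\<close> for every center \<open>u\<close>. So \<open>Sigma_inf X\<close> is the set of
  centers of hyperspheres containing \<open>X\<close>.
\<close>

section \<open>Polynomial functions\<close>

lemma polyfun_sum:
  assumes "\<And>i. i \<in> S \<Longrightarrow> f i \<in> polyfun C"
  shows "(\<lambda>x. \<Sum>i\<in>S. f i x) \<in> polyfun C"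
  using assms
proof (induction S rule: infinite_finite_induct)
  case (insert i S)
  then show ?case
    using pf_add[of "f i" C "\<lambda>x. \<Sum>i\<in>S. f i x"] by simp
qed (simp_all add: pf_const)

lemma polyfun_prod:
  assumes "\<And>i. i \<in> S \<Longrightarrow> f i \<in> polyfun C"
  shows "(\<lambda>x. \<Prod>i\<in>S. f i x) \<in> polyfun C"
  using assms
proof (induction S rule: infinite_finite_induct)
  case (insert i S)
  then show ?case
    using pf_mult[of "f i" C "\<lambda>x. \<Prod>i\<in>S. f i x"] by simp
qed (simp_all add: pf_const)

lemma polyfun_diff:
  assumes "f \<in> polyfun C" "g \<in> polyfun C"
  shows "(\<lambda>x. f x - g x) \<in> polyfun C"
proof -
  have "(\<lambda>x. f x + (- 1) * g x) \<in> polyfun C"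
    by (intro pf_add pf_mult pf_const assms)
  then show ?thesis by simp
qed

lemma polyfun_det:
  assumes "\<And>i j. (\<lambda>x. A x $ i $ j) \<in> polyfun C"
  shows "(\<lambda>x. det (A x :: complex^'n^'n)) \<in> polyfun C"
  unfolding det_def
  by (intro polyfun_sum pf_mult pf_const polyfun_prod assms)

lemma polyfun_compose:
  assumes "f \<in> polyfun C" and "\<And>c. c \<in> C \<Longrightarrow> (\<lambda>x. c (\<phi> x)) \<in> polyfun C'"
  shows "(\<lambda>x. f (\<phi> x)) \<in> polyfun C'"
  using assms(1) by induction (auto intro: pf_const pf_add pf_mult assms(2))

lemma polyfun_component: "(\<lambda>x. x $ i) \<in> polyfun coordsV"
  by (auto simp: coordsV_def intro: pf_coord)

lemma polyfun_bdot:
  assumes "\<And>i. (\<lambda>x. v x $ i) \<in> polyfun C" "\<And>i. (\<lambda>x. w x $ i) \<in> polyfun C"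
  shows "(\<lambda>x. bdot (v x) (w x)) \<in> polyfun C"
  unfolding bdot_def by (intro polyfun_sum pf_mult assms)

lemma polyfun_fst_component: "(\<lambda>p. fst p $ i) \<in> polyfun coordsP"
  by (auto simp: coordsP_def intro: pf_coord)

lemma polyfun_snd_component: "(\<lambda>p. snd p $ i) \<in> polyfun coordsP"
  by (auto simp: coordsP_def intro: pf_coord)

section \<open>The complex bilinear form and orthogonality to spans\<close>

lemma bdot_add_left: "bdot (x + y) z = bdot x z + bdot y z"
  by (simp add: bdot_def ring_distribs sum.distrib)

lemma bdot_diff_left: "bdot (x - y) z = bdot x z - bdot y z"
  by (simp add: bdot_def ring_distribs sum_subtractf)

lemma bdot_diff_right: "bdot x (y - z) = bdot x y - bdot x z"
  by (simp add: bdot_def ring_distribs sum_subtractf)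

lemma bdot_commute: "bdot x y = bdot y x"
  by (simp add: bdot_def mult.commute)

lemma bdot_scale_left: "bdot (c *s x) y = c * bdot x y"
  by (simp add: bdot_def sum_distrib_left mult.assoc)

lemma bdot_scale_right: "bdot x (c *s y) = c * bdot x y"
  by (simp add: bdot_def sum_distrib_left mult_ac)

lemma bdot_zero [simp]: "bdot 0 x = 0" "bdot x 0 = 0"
  by (simp_all add: bdot_def)

lemma bdot_axis: "bdot (axis i 1) x = x $ i"
proof -
  have "bdot (axis i 1) x = (\<Sum>k\<in>UNIV. if k = i then x $ k else 0)"
    unfolding bdot_def by (rule sum.cong) (auto simp: axis_def)
  then show ?thesis by simp
qed

lemma subspace_orthogonal: "vec.subspace {x. bdot w x = 0}"
  by (auto simp: vec.subspace_def bdot_scale_right) (simp add: bdot_commute[of w] bdot_add_left)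

lemma bdot_span_eq_0:
  assumes "y \<in> vec.span S" "\<And>s. s \<in> S \<Longrightarrow> bdot w s = 0"
  shows "bdot w y = 0"
  using vec.span_minimal[of S "{x. bdot w x = 0}"] subspace_orthogonal[of w] assms by auto

section \<open>Derivatives and gradients of polynomial functions\<close>

text \<open>The derivative vector is carried through the induction together with its polynomial
  coordinates, because \<open>gradient\<close> is defined by complex partial derivatives and can be
  identified only once differentiability is known.\<close>

lemma polyfun_has_derivative_ex:
  assumes "f \<in> polyfun (coordsV :: (complex^'n \<Rightarrow> complex) set)"
  shows "\<exists>df. (\<forall>i. (\<lambda>x. df x $ i) \<in> polyfun coordsV) \<and>
              (\<forall>x. (f has_derivative (\<lambda>h. bdot (df x) h)) (at x))"
  using assms
proof induction
  case (pf_const c)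
  show ?case
    by (rule exI[of _ "\<lambda>_. 0"]) (auto intro: polyfun.pf_const)
next
  case (pf_coord f)
  then obtain i where f: "f = (\<lambda>x. x $ i)" by (auto simp: coordsV_def)
  have "(f has_derivative (\<lambda>h. bdot (axis i 1) h)) (at x)" for x
    unfolding f bdot_axis by (rule bounded_linear_imp_has_derivative) (rule bounded_linear_vec_nth)
  then show ?case
    by (intro exI[of _ "\<lambda>_. axis i 1"]) (auto intro: polyfun.pf_const)
next
  case (pf_add f g)
  then obtain df dg where
    "\<forall>i. (\<lambda>x. df x $ i) \<in> polyfun coordsV" "\<forall>x. (f has_derivative (\<lambda>h. bdot (df x) h)) (at x)"
    "\<forall>i. (\<lambda>x. dg x $ i) \<in> polyfun coordsV" "\<forall>x. (g has_derivative (\<lambda>h. bdot (dg x) h)) (at x)"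
    by blast
  then show ?case
    by (intro exI[of _ "\<lambda>x. df x + dg x"])
       (auto simp: bdot_add_left intro: polyfun.pf_add has_derivative_add)
next
  case (pf_mult f g)
  then obtain df dg where d:
    "\<forall>i. (\<lambda>x. df x $ i) \<in> polyfun coordsV" "\<And>x. (f has_derivative (\<lambda>h. bdot (df x) h)) (at x)"
    "\<forall>i. (\<lambda>x. dg x $ i) \<in> polyfun coordsV" "\<And>x. (g has_derivative (\<lambda>h. bdot (dg x) h)) (at x)"
    by blast
  have "((\<lambda>x. f x * g x) has_derivative (\<lambda>h. bdot (f x *s dg x + g x *s df x) h)) (at x)" for x
    by (rule has_derivative_eq_rhs[OF has_derivative_mult[OF d(2) d(4)]])
       (auto simp: bdot_add_left bdot_scale_left mult.commute)
  moreover have "(\<lambda>x. (f x *s dg x + g x *s df x) $ i) \<in> polyfun coordsV" for i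
    unfolding vector_add_component vector_smult_component
    using d(1,3) pf_mult.hyps by (intro polyfun.pf_add polyfun.pf_mult) auto
  ultimately show ?case
    by (intro exI[of _ "\<lambda>x. f x *s dg x + g x *s df x"]) simp
qed

text \<open>\<open>has_derivative\<close> is real differentiability, but a derivative of the form
  \<open>bdot d\<close> is complex linear. Composing with the inclusion of a complex coordinate line
  therefore turns it into a complex derivative.\<close>

lemma has_derivative_imp_gradient:
  fixes x :: "complex^'n"
  assumes "(f has_derivative (\<lambda>h. bdot d h)) (at x)"
  shows "gradient f x = d"
proof -
  have "partial_deriv f i x = d $ i" for i
  proof -
    let ?l = "\<lambda>t::complex. (\<chi> j. if j = i then t else 0) :: complex^'n"
    have l: "?l t = t *s axis i 1" for t
      by (auto simp: vec_eq_iff axis_def)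
    have bl: "bounded_linear ?l"
      by (intro linear_conv_bounded_linear[THEN iffD1] linearI) (auto simp: vec_eq_iff)
    have "((\<lambda>t. x + ?l t) has_derivative ?l) (at 0)"
      by (auto intro!: derivative_eq_intros bounded_linear_imp_has_derivative bl)
    moreover have "?l 0 = 0" by (simp add: vec_eq_iff)
    ultimately have "((\<lambda>t. f (x + ?l t)) has_derivative (\<lambda>t. bdot d (?l t))) (at 0)"
      using has_derivative_compose[of "\<lambda>t. x + ?l t" ?l 0 UNIV f "\<lambda>h. bdot d h"] assms by simp
    moreover have "(\<lambda>t. bdot d (?l t)) = (*) (d $ i)"
      unfolding l bdot_scale_right using bdot_axis[of i d] by (simp add: bdot_commute fun_eq_iff)
    ultimately have "((\<lambda>t. f (x + ?l t)) has_field_derivative d $ i) (at 0)"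
      by (simp add: has_field_derivative_def)
    then show ?thesis
      unfolding partial_deriv_def by (rule DERIV_imp_deriv)
  qed
  then show ?thesis by (simp add: gradient_def vec_eq_iff)
qed

lemma polyfun_has_derivative:
  assumes "f \<in> polyfun coordsV"
  shows "(f has_derivative (\<lambda>h. bdot (gradient f x) h)) (at x)"
  using polyfun_has_derivative_ex[OF assms] has_derivative_imp_gradient by metis

lemma polyfun_gradient:
  assumes "f \<in> polyfun coordsV"
  shows "(\<lambda>x. gradient f x $ i) \<in> polyfun coordsV"
proof -
  obtain df where df: "\<And>i. (\<lambda>x. df x $ i) \<in> polyfun coordsV"
      "\<And>x. (f has_derivative (\<lambda>h. bdot (df x) h)) (at x)"
    using polyfun_has_derivative_ex[OF assms] by blast
  have "gradient f = df"
    using has_derivative_imp_gradient[OF df(2)] by (simp add: fun_eq_iff)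
  with df(1) show ?thesis by simp
qed

lemma continuous_on_polyfun:
  assumes "f \<in> polyfun (coordsV :: (complex^'n \<Rightarrow> complex) set)"
  shows "continuous_on S f"
  using polyfun_has_derivative[OF assms] has_derivative_continuous continuous_at_imp_continuous_on
  by blast

lemma gradient_bdot: "gradient (\<lambda>x. bdot b x + c) x = b"
proof (rule has_derivative_imp_gradient)
  have "bounded_linear (bdot b)"
    by (intro linear_conv_bounded_linear[THEN iffD1] linearI)
      (simp_all add: bdot_def ring_distribs sum.distrib scaleR_sum_right)
  then show "((\<lambda>x. bdot b x + c) has_derivative bdot b) (at x)"
    by (auto intro!: derivative_eq_intros bounded_linear_imp_has_derivative)
qed

lemma gradient_sphere: "gradient (\<lambda>x. bdot (x - c) (x - c) - r) x = 2 *s (x - c)"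
proof (rule has_derivative_imp_gradient)
  have "((\<lambda>x. bdot (x - c) (x - c) - r) has_derivative
      (\<lambda>h. \<Sum>i\<in>UNIV. (x - c) $ i * h $ i + h $ i * (x - c) $ i)) (at x)"
    unfolding bdot_def
    by (auto intro!: derivative_eq_intros bounded_linear_vec_nth[THEN bounded_linear_imp_has_derivative])
  moreover have "(\<Sum>i\<in>UNIV. (x - c) $ i * h $ i + h $ i * (x - c) $ i) = bdot (2 *s (x - c)) h" for h
    unfolding bdot_def by (rule sum.cong) (auto simp: algebra_simps)
  ultimately show "((\<lambda>x. bdot (x - c) (x - c) - r) has_derivative bdot (2 *s (x - c))) (at x)"
    by simp
qed

lemma polyfun_bdot_affine: "(\<lambda>x. bdot b x + c) \<in> polyfun coordsV"
  by (intro pf_add polyfun_bdot pf_const polyfun_component)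

lemma polyfun_sphere: "(\<lambda>x. bdot (x - c) (x - c) - r) \<in> polyfun coordsV"
  by (intro polyfun_diff polyfun_bdot pf_const)
     (simp_all, (intro polyfun_diff polyfun_component pf_const)+)

text \<open>The linear coefficients of a first-order Taylor expansion may be taken polynomial; this
  stands in for Nakayama's lemma at a point where the gradients of the ideal span everything.\<close>

lemma polyfun_taylor_ex:
  assumes "f \<in> polyfun (coordsV :: (complex^'n \<Rightarrow> complex) set)"
  shows "\<exists>B. (\<forall>j. (\<lambda>x. B x $ j) \<in> polyfun coordsV) \<and> B x0 = gradient f x0 \<and>
             (\<forall>x. f x - f x0 = bdot (B x) (x - x0))"
  using assms
proof induction
  case (pf_const c)
  show ?case
    by (rule exI[of _ "\<lambda>_. 0"]) (auto intro: polyfun.pf_const simp: has_derivative_imp_gradient)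
next
  case (pf_coord f)
  then obtain i where f: "f = (\<lambda>x. x $ i)" by (auto simp: coordsV_def)
  have "gradient f x0 = axis i 1"
    using gradient_bdot[of "axis i 1" 0 x0] by (simp add: f bdot_axis)
  then show ?case
    by (intro exI[of _ "\<lambda>_. axis i 1"]) (auto intro: polyfun.pf_const simp: f bdot_axis)
next
  case (pf_add f g)
  then obtain Bf Bg where
    B: "\<forall>j. (\<lambda>x. Bf x $ j) \<in> polyfun coordsV" "Bf x0 = gradient f x0"
       "\<And>x. f x - f x0 = bdot (Bf x) (x - x0)"
       "\<forall>j. (\<lambda>x. Bg x $ j) \<in> polyfun coordsV" "Bg x0 = gradient g x0"
       "\<And>x. g x - g x0 = bdot (Bg x) (x - x0)"
    by blast
  have "((\<lambda>x. f x + g x) has_derivative (\<lambda>h. bdot (gradient f x0 + gradient g x0) h)) (at x0)"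
    unfolding bdot_add_left
    by (intro has_derivative_add polyfun_has_derivative pf_add.hyps)
  from has_derivative_imp_gradient[OF this]
  have "Bf x0 + Bg x0 = gradient (\<lambda>x. f x + g x) x0" by (simp add: B)
  moreover have "(\<lambda>x. (Bf x + Bg x) $ j) \<in> polyfun coordsV" for j
    unfolding vector_add_component using B(1,4) by (intro polyfun.pf_add) auto
  moreover have "(f x + g x) - (f x0 + g x0) = bdot (Bf x + Bg x) (x - x0)" for x
    unfolding bdot_add_left B(3,6)[symmetric] by simp
  ultimately show ?case
    by (intro exI[of _ "\<lambda>x. Bf x + Bg x"]) simp
next
  case (pf_mult f g)
  then obtain Bf Bg where
    B: "\<forall>j. (\<lambda>x. Bf x $ j) \<in> polyfun coordsV" "Bf x0 = gradient f x0"
       "\<And>x. f x - f x0 = bdot (Bf x) (x - x0)"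
       "\<forall>j. (\<lambda>x. Bg x $ j) \<in> polyfun coordsV" "Bg x0 = gradient g x0"
       "\<And>x. g x - g x0 = bdot (Bg x) (x - x0)"
    by blast
  have "((\<lambda>x. f x * g x) has_derivative
      (\<lambda>h. bdot (g x0 *s gradient f x0 + f x0 *s gradient g x0) h)) (at x0)"
    by (rule has_derivative_eq_rhs[OF has_derivative_mult[OF polyfun_has_derivative
          polyfun_has_derivative]]) (auto simp: pf_mult.hyps bdot_add_left bdot_scale_left)
  from has_derivative_imp_gradient[OF this]
  have "g x0 *s Bf x0 + f x0 *s Bg x0 = gradient (\<lambda>x. f x * g x) x0" by (simp add: B)
  \<comment> \<open>The coefficients come from \<open>f x * g x - f x0 * g x0 = g x * (f x - f x0) +
    f x0 * (g x - g x0)\<close>.\<close>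
  moreover have "(\<lambda>x. (g x *s Bf x + f x0 *s Bg x) $ j) \<in> polyfun coordsV" for j
    unfolding vector_add_component vector_smult_component using B(1,4) pf_mult.hyps
    by (intro polyfun.pf_add polyfun.pf_mult polyfun.pf_const) auto
  moreover have "f x * g x - f x0 * g x0 = bdot (g x *s Bf x + f x0 *s Bg x) (x - x0)" for x
    unfolding bdot_add_left bdot_scale_left B(3,6)[symmetric] by (simp add: algebra_simps)
  ultimately show ?case
    by (intro exI[of _ "\<lambda>x. g x *s Bf x + f x0 *s Bg x"]) simp
qed

section \<open>Zariski closed sets\<close>

lemma zariski_closed_zero_set: "F \<subseteq> polyfun C \<Longrightarrow> zariski_closed C (zero_set F)"
  by (auto simp: zariski_closed_def)

lemma zariski_closed_Int:
  assumes "zariski_closed C A" "zariski_closed C B"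
  shows "zariski_closed C (A \<inter> B)"
proof -
  obtain F G where "F \<subseteq> polyfun C" "A = zero_set F" "G \<subseteq> polyfun C" "B = zero_set G"
    using assms by (auto simp: zariski_closed_def)
  then have "F \<union> G \<subseteq> polyfun C" "A \<inter> B = zero_set (F \<union> G)"
    by (auto simp: zero_set_def)
  then show ?thesis unfolding zariski_closed_def by blast
qed

lemma zariski_closed_level:
  assumes "f \<in> polyfun C"
  shows "zariski_closed C {x. f x = c}"
proof -
  have "{x. f x = c} = zero_set {\<lambda>x. f x - c}" by (auto simp: zero_set_def)
  then show ?thesis
    using polyfun_diff[OF assms pf_const] zariski_closed_zero_set by (metis empty_subsetI insert_subset)
qed

lemma zariski_closed_vimage:
  assumes "zariski_closed C S" and "\<And>c. c \<in> C \<Longrightarrow> (\<lambda>x. c (\<phi> x)) \<in> polyfun C'"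
  shows "zariski_closed C' (\<phi> -` S)"
proof -
  obtain F where F: "F \<subseteq> polyfun C" "S = zero_set F"
    using assms(1) by (auto simp: zariski_closed_def)
  have "(\<lambda>x. f (\<phi> x)) \<in> polyfun C'" if "f \<in> F" for f
    by (rule polyfun_compose[of f C]) (use that F assms(2) in auto)
  then have "(\<lambda>f x. f (\<phi> x)) ` F \<subseteq> polyfun C'"
    by auto
  moreover have "\<phi> -` S = zero_set ((\<lambda>f x. f (\<phi> x)) ` F)"
    by (auto simp: F zero_set_def)
  ultimately show ?thesis unfolding zariski_closed_def by blast
qed

text \<open>Any closed set containing \<open>S\<close> is cut out by polynomials that already lie in
  the ideal of \<open>S\<close>. This form shows that the closure is itself closed.\<close>

lemma zariski_closure_eq: "zariski_closure C S = zero_set (vanishing_ideal C S)"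
proof
  have "zariski_closed C (zero_set (vanishing_ideal C S))"
    by (rule zariski_closed_zero_set) (auto simp: vanishing_ideal_def)
  moreover have "S \<subseteq> zero_set (vanishing_ideal C S)"
    by (auto simp: vanishing_ideal_def zero_set_def)
  ultimately show "zariski_closure C S \<subseteq> zero_set (vanishing_ideal C S)"
    by (auto simp: zariski_closure_def)
next
  have "zero_set (vanishing_ideal C S) \<subseteq> Z" if "zariski_closed C Z" "S \<subseteq> Z" for Z
    using that unfolding zariski_closed_def zero_set_def vanishing_ideal_def by blast
  then show "zero_set (vanishing_ideal C S) \<subseteq> zariski_closure C S"
    by (auto simp: zariski_closure_def)
qed

lemma zariski_closed_closure: "zariski_closed C (zariski_closure C S)"
  unfolding zariski_closure_eq by (rule zariski_closed_zero_set) (auto simp: vanishing_ideal_def)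

lemma zariski_closure_superset: "S \<subseteq> zariski_closure C S"
  by (auto simp: zariski_closure_def)

lemma zariski_closure_minimal: "zariski_closed C Z \<Longrightarrow> S \<subseteq> Z \<Longrightarrow> zariski_closure C S \<subseteq> Z"
  by (auto simp: zariski_closure_def)

lemma zariski_closed_singleton: "zariski_closed coordsV {x0 :: complex^'n}"
proof -
  have "{x0} = zero_set (range (\<lambda>i x. x $ i - x0 $ i))"
    by (auto simp: zero_set_def vec_eq_iff)
  moreover have "range (\<lambda>i x. x $ i - x0 $ i) \<subseteq> polyfun coordsV"
    by (auto intro: polyfun_diff polyfun_component pf_const)
  ultimately show ?thesis unfolding zariski_closed_def by blast
qed

lemma zariski_irreducible_singleton: "zariski_irreducible coordsV {x0 :: complex^'n}"
proof -
  have "{x0} = A \<or> {x0} = B" if "{x0} = A \<union> B" for A B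
    using that by (metis Un_singleton_iff)
  then show ?thesis
    unfolding zariski_irreducible_def by (simp add: zariski_closed_singleton)
qed

text \<open>If neither part of a closed decomposition contained \<open>S\<close>, one equation of
  each part would be nonzero somewhere on \<open>S\<close>, while their product vanishes on
  \<open>S\<close>. The criterion is meant for arcs, where primality comes from the identity
  theorem.\<close>

lemma zariski_irreducible_closure:
  assumes "S \<noteq> {}"
    and prime: "\<And>f g. f \<in> polyfun C \<Longrightarrow> g \<in> polyfun C \<Longrightarrow> \<forall>x\<in>S. f x * g x = 0 \<Longrightarrow>
      (\<forall>x\<in>S. f x = 0) \<or> (\<forall>x\<in>S. g x = 0)"
  shows "zariski_irreducible C (zariski_closure C S)"
proof -
  let ?Z = "zariski_closure C S"
  have split: "?Z = A \<or> ?Z = B"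
    if A: "zariski_closed C A" and B: "zariski_closed C B" and Z: "?Z = A \<union> B" for A B
  proof (rule ccontr)
    assume not: "\<not> ?thesis"
    obtain F G where FG: "F \<subseteq> polyfun C" "A = zero_set F" "G \<subseteq> polyfun C" "B = zero_set G"
      using A B by (auto simp: zariski_closed_def)
    have "\<not> S \<subseteq> A" "\<not> S \<subseteq> B"
      using zariski_closure_minimal[OF A] zariski_closure_minimal[OF B] Z not by blast+
    then obtain f g where fg: "f \<in> F" "\<not> (\<forall>x\<in>S. f x = 0)" "g \<in> G" "\<not> (\<forall>x\<in>S. g x = 0)"
      using FG by (auto simp: zero_set_def)
    have "\<forall>x\<in>S. f x * g x = 0"
      using zariski_closure_superset[of S C] Z FG fg(1,3) by (auto simp: zero_set_def)
    with prime[of f g] fg FG show False by blast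
  qed
  have "?Z \<noteq> {}" using zariski_closure_superset[of S C] assms(1) by blast
  then show ?thesis
    unfolding zariski_irreducible_def
    by (intro conjI allI impI zariski_closed_closure split) simp_all
qed

lemma zariski_closed_irreducible: "zariski_irreducible C S \<Longrightarrow> zariski_closed C S"
  by (simp add: zariski_irreducible_def)

lemma zariski_irreducible_subset_Un:
  assumes "zariski_irreducible C S" "zariski_closed C A" "zariski_closed C B" "S \<subseteq> A \<union> B"
  shows "S \<subseteq> A \<or> S \<subseteq> B"
proof -
  have "S = (S \<inter> A) \<union> (S \<inter> B)" using assms(4) by blast
  moreover have "zariski_closed C (S \<inter> A)" "zariski_closed C (S \<inter> B)"
    using assms(1-3) zariski_closed_Int zariski_closed_irreducible by blast+
  ultimately have "S = S \<inter> A \<or> S = S \<inter> B"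
    using assms(1) unfolding zariski_irreducible_def by blast
  then show ?thesis by blast
qed

lemma zero_set_vanishing_ideal:
  assumes "zariski_closed C S" and "\<And>f. f \<in> vanishing_ideal C S \<Longrightarrow> f x = 0"
  shows "x \<in> S"
proof -
  obtain F where F: "F \<subseteq> polyfun C" "S = zero_set F"
    using assms(1) by (auto simp: zariski_closed_def)
  then have "F \<subseteq> vanishing_ideal C S"
    by (auto simp: vanishing_ideal_def zero_set_def)
  with assms(2) F show ?thesis by (auto simp: zero_set_def)
qed

section \<open>Chains of irreducible closed sets and the dimension of a curve\<close>

lemma dim_ge_mono:
  assumes "dim_ge C S k" "S \<subseteq> T"
  shows "dim_ge C T k"
proof -
  obtain Z where "\<forall>i\<le>k. zariski_irreducible C (Z i) \<and> Z i \<subseteq> S" "\<forall>i<k. Z i \<subset> Z (Suc i)"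
    using assms by (auto simp: dim_ge_def)
  with assms(2) show ?thesis
    unfolding dim_ge_def by (intro exI[of _ Z]) auto
qed

lemma dim_ge_antimono:
  assumes "dim_ge C S k" "l \<le> k"
  shows "dim_ge C S l"
proof -
  obtain Z where "\<forall>i\<le>k. zariski_irreducible C (Z i) \<and> Z i \<subseteq> S" "\<forall>i<k. Z i \<subset> Z (Suc i)"
    using assms by (auto simp: dim_ge_def)
  with assms(2) show ?thesis
    unfolding dim_ge_def by (intro exI[of _ Z]) (auto simp: less_le_trans)
qed

lemma dim_ge_1_iff:
  "dim_ge C S 1 \<longleftrightarrow> (\<exists>A B. zariski_irreducible C A \<and> zariski_irreducible C B \<and> A \<subset> B \<and> B \<subseteq> S)"
  (is "_ \<longleftrightarrow> ?R")
proof
  assume "dim_ge C S 1"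
  then obtain Z where "\<forall>i\<le>1. zariski_irreducible C (Z i) \<and> Z i \<subseteq> S" "\<forall>i<1. Z i \<subset> Z (Suc i)"
    by (auto simp: dim_ge_def)
  then show ?R by (intro exI[of _ "Z 0"] exI[of _ "Z 1"]) auto
next
  assume ?R
  then obtain A B where "zariski_irreducible C A" "zariski_irreducible C B" "A \<subset> B" "B \<subseteq> S"
    by blast
  then show "dim_ge C S 1"
    unfolding dim_ge_def by (intro exI[of _ "\<lambda>i::nat. if i = 0 then A else B"]) auto
qed

lemma dim_ge_2I:
  assumes "zariski_irreducible C A" "zariski_irreducible C B" "zariski_irreducible C S"
    "A \<subset> B" "B \<subset> S"
  shows "dim_ge C S 2"
proof -
  let ?Z = "\<lambda>i::nat. if i = 0 then A else if i = 1 then B else S"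
  have "zariski_irreducible C (?Z i) \<and> ?Z i \<subseteq> S" for i
    using assms by auto
  moreover have "?Z i \<subset> ?Z (Suc i)" if "i < 2" for i
    using that assms(4,5) less_2_cases[of i] by auto
  ultimately show ?thesis unfolding dim_ge_def by (intro exI[of _ ?Z]) simp
qed

text \<open>A proper inclusion \<open>B \<subset> X\<close> would extend
  \<open>A \<subset> B\<close> to a chain of length two. With a singleton for \<open>A\<close>, this
  makes the closure of an arc fill the curve.\<close>

lemma irreducible_curve_closed_subset_eq:
  assumes "irreducible_curve X" "zariski_irreducible coordsV A" "zariski_irreducible coordsV B"
    "A \<subset> B" "B \<subseteq> X"
  shows "B = X"
proof (rule ccontr)
  assume "B \<noteq> X"
  then have "dim_ge coordsV X 2"
    using assms dim_ge_2I[of coordsV A B X] by (simp add: irreducible_curve_def psubset_eq)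
  then show False using assms(1) by (simp add: irreducible_curve_def)
qed

lemma alg_dim_irreducible_curve:
  assumes "irreducible_curve X"
  shows "alg_dim coordsV X = 1"
  unfolding alg_dim_def
proof (rule Greatest_equality)
  show "dim_ge coordsV X 1" using assms by (simp add: irreducible_curve_def)
  show "k \<le> 1" if "dim_ge coordsV X k" for k
  proof (rule ccontr)
    assume "\<not> k \<le> 1"
    then have "dim_ge coordsV X 2" using that dim_ge_antimono[of coordsV X k 2] by simp
    then show False using assms by (simp add: irreducible_curve_def)
  qed
qed

section \<open>Frames adapted to points of maximal rank\<close>

lemma has_derivative_vec_lambda:
  fixes a :: "'n::finite \<Rightarrow> 'a::real_normed_vector \<Rightarrow> complex"
  assumes "\<And>i. (a i has_derivative a' i) (at x)"
  shows "((\<lambda>x. \<chi> i. a i x) has_derivative (\<lambda>h. \<chi> i. a' i h)) (at x)"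
  unfolding has_derivative_componentwise_within[of "\<lambda>x. \<chi> i. a i x"]
proof
  fix b :: "complex^'n" assume "b \<in> Basis"
  then obtain i u where b: "b = axis i u" by (auto simp: Basis_vec_def)
  show "((\<lambda>x. (\<chi> i. a i x) \<bullet> b) has_derivative (\<lambda>h. (\<chi> i. a' i h) \<bullet> b)) (at x)"
    unfolding b inner_axis using has_derivative_inner_left[OF assms] by simp
qed

lemma bounded_linear_matrix_vector_mult: "bounded_linear ((*v) (A :: complex^'n^'n))"
  by (intro linear_conv_bounded_linear[THEN iffD1] linearI)
     (simp_all add: vec_eq_iff matrix_vector_mult_def ring_distribs sum.distrib scaleR_sum_right)

lemma det_nonzero_if_kernel_trivial:
  fixes A :: "complex^'n^'n"
  assumes "\<And>h. A *v h = 0 \<Longrightarrow> h = 0"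
  shows "det A \<noteq> 0"
  using assms matrix_left_invertible_ker[of A] invertible_det_nz[of A] invertible_left_inverse[of A]
  by blast

text \<open>The \<open>a i\<close> serve as local coordinates at \<open>x0\<close>: those with index
  in \<open>J\<close> vanish on \<open>X\<close>, the others are candidate parameters along it. By
  \<open>rank_le\<close> no point of \<open>X\<close> has more independent normals than the
  functions indexed by \<open>J\<close> supply at \<open>x0\<close>.\<close>

locale adapted_frame =
  fixes X :: "(complex^'n) set" and a :: "'n \<Rightarrow> complex^'n \<Rightarrow> complex"
    and J :: "'n set" and x0 :: "complex^'n"
  assumes closed: "zariski_closed coordsV X"
    and base: "x0 \<in> X"
    and a_poly: "\<And>i. a i \<in> polyfun coordsV"
    and a_vanish: "\<And>i x. i \<in> J \<Longrightarrow> x \<in> X \<Longrightarrow> a i x = 0"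
    and rank_le: "\<And>x. x \<in> X \<Longrightarrow> vec.dim (normal_space_at X x) \<le> card J"
    and nondegenerate: "det (\<chi> i. gradient (a i) x0) \<noteq> 0"
begin

definition jac :: "complex^'n \<Rightarrow> complex^'n^'n" where
  "jac x = (\<chi> i. gradient (a i) x)"

definition D :: "complex^'n \<Rightarrow> complex" where
  "D x = det (jac x)"

text \<open>Cramer's solution of \<open>jac x *v v = D x *s axis p 1\<close>, multiplied once more by \<open>D\<close> so that
  it vanishes wherever the frame degenerates.\<close>

definition tangent :: "'n \<Rightarrow> complex^'n \<Rightarrow> complex^'n" where
  "tangent p x = D x *s (\<chi> k. det (\<chi> i j. if j = k then axis p 1 $ i else jac x $ i $ j))"

lemma jac_mult_component: "(jac x *v h) $ i = bdot (gradient (a i) x) h"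
  by (simp add: jac_def matrix_vector_mult_def bdot_def)

lemma jac_tangent: "jac x *v tangent p x = (D x)\<^sup>2 *s axis p 1"
proof (cases "D x = 0")
  case True
  then show ?thesis by (simp add: tangent_def vec_eq_iff jac_mult_component)
next
  case False
  let ?y = "\<chi> k. det (\<chi> i j. if j = k then axis p 1 $ i else jac x $ i $ j) / det (jac x)"
  have "jac x *v ?y = axis p 1"
    using cramer[of "jac x" ?y "axis p 1"] False by (simp add: D_def)
  moreover have "tangent p x = (D x)\<^sup>2 *s ?y"
    using False by (auto simp: tangent_def vec_eq_iff D_def power2_eq_square)
  ultimately show ?thesis by (simp add: vec.scale)
qed

lemma gradient_tangent:
  "bdot (tangent p x) (gradient (a i) x) = (if i = p then (D x)\<^sup>2 else 0)"
  using arg_cong[OF jac_tangent[of x p], of "\<lambda>v. v $ i"]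
  by (simp add: jac_mult_component bdot_commute axis_def)

lemma polyfun_jac: "(\<lambda>x. jac x $ i $ j) \<in> polyfun coordsV"
  by (simp add: jac_def polyfun_gradient a_poly)

lemma polyfun_D: "D \<in> polyfun coordsV"
  unfolding D_def[abs_def] by (intro polyfun_det polyfun_jac)

lemma polyfun_tangent: "(\<lambda>x. tangent p x $ k) \<in> polyfun coordsV"
proof -
  have "(\<lambda>x. (\<chi> i j. if j = k then axis p 1 $ i else jac x $ i $ j) $ i $ j) \<in> polyfun coordsV" for i j
    by (cases "j = k") (simp_all add: pf_const polyfun_jac)
  then show ?thesis
    unfolding tangent_def by (auto intro!: pf_mult polyfun_D polyfun_det)
qed

lemma D_base: "D x0 \<noteq> 0"
  using nondegenerate by (simp add: D_def jac_def)

lemma inj_gradients: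
  assumes "D x \<noteq> 0"
  shows "inj (\<lambda>i. gradient (a i) x)"
proof (rule injI, rule ccontr)
  fix i j assume "gradient (a i) x = gradient (a j) x" "i \<noteq> j"
  then have "det (jac x) = 0"
    by (intro det_identical_rows[of i j]) (auto simp: row_def jac_def)
  with assms show False by (simp add: D_def)
qed

lemma independent_gradients:
  assumes "D x \<noteq> 0"
  shows "vec.independent (range (\<lambda>i. gradient (a i) x))"
proof -
  have "rows (jac x) = range (\<lambda>i. gradient (a i) x)"
    by (auto simp: rows_def row_def jac_def)
  then show ?thesis
    using det_dependent_rows[of "jac x"] assms by (auto simp: D_def)
qed

lemma gradient_frame_in_normal_space:
  assumes "i \<in> J"
  shows "gradient (a i) x \<in> normal_space_at X x"
  unfolding normal_space_at_def
  by (rule vec.span_base) (use assms a_poly a_vanish in \<open>auto simp: vanishing_ideal_def\<close>)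

text \<open>Where \<open>D\<close> is nonzero the gradients with index in \<open>J\<close> are
  independent, and there are already as many of them as \<open>rank_le\<close> allows.\<close>

lemma normal_space_spanned:
  assumes "x \<in> X" "D x \<noteq> 0"
  shows "normal_space_at X x \<subseteq> vec.span ((\<lambda>i. gradient (a i) x) ` J)"
    and "vec.dim (normal_space_at X x) = card J"
proof -
  let ?B = "(\<lambda>i. gradient (a i) x) ` J"
  have ind: "vec.independent ?B"
    by (rule vec.independent_mono[OF independent_gradients[OF assms(2)]]) auto
  have sub: "?B \<subseteq> normal_space_at X x"
    by (intro image_subsetI gradient_frame_in_normal_space)
  have card: "card ?B = card J"
    by (rule card_image[OF inj_on_subset[OF inj_gradients[OF assms(2)] subset_UNIV]])
  show "normal_space_at X x \<subseteq> vec.span ?B"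
    using vec.card_ge_dim_independent[OF sub ind] rank_le[OF assms(1)] card by simp
  show "vec.dim (normal_space_at X x) = card J"
    using vec.independent_card_le_dim[OF sub ind] rank_le[OF assms(1)] card by simp
qed

text \<open>Where \<open>D\<close> vanishes so does the field; the extra factor \<open>D\<close>
  takes care of this case. Elsewhere the normal space is spanned by gradients with index in
  \<open>J\<close>, and \<open>p\<close> lies outside \<open>J\<close>.\<close>

lemma tangent_orthogonal:
  assumes "x \<in> X" "p \<notin> J" "y \<in> normal_space_at X x"
  shows "bdot (tangent p x) y = 0"
proof (cases "D x = 0")
  case True
  then show ?thesis by (simp add: tangent_def)
next
  case False
  then have "y \<in> vec.span ((\<lambda>i. gradient (a i) x) ` J)"
    using normal_space_spanned assms by blast
  then show ?thesis
    by (rule bdot_span_eq_0) (use assms(2) in \<open>auto simp: gradient_tangent\<close>)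
qed

text \<open>Gradients of members of the ideal are normal vectors. That the ideal is stable under
  this derivation is what permits repeated differentiation along an arc.\<close>

lemma vanishing_ideal_tangent:
  assumes "f \<in> vanishing_ideal coordsV X" "p \<notin> J"
  shows "(\<lambda>x. bdot (tangent p x) (gradient f x)) \<in> vanishing_ideal coordsV X"
proof -
  have "gradient f x \<in> normal_space_at X x" for x
    unfolding normal_space_at_def using assms by (intro vec.span_base) auto
  then have "\<forall>x\<in>X. bdot (tangent p x) (gradient f x) = 0"
    using tangent_orthogonal assms(2) by blast
  moreover have "f \<in> polyfun coordsV" using assms by (simp add: vanishing_ideal_def)
  ultimately show ?thesis
    unfolding vanishing_ideal_def
    using polyfun_bdot[OF polyfun_tangent polyfun_gradient] by blast
qed

section \<open>Holomorphic arcs along the coordinate directions\<close>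

text \<open>By the inverse function theorem the \<open>a i\<close> are coordinates near
  \<open>x0\<close>. The arc is the preimage of the complex line through the image of
  \<open>x0\<close> on which only coordinate \<open>p\<close> moves.\<close>

lemma arc_exists:
  obtains \<epsilon> \<gamma> where "\<epsilon> > 0" "\<gamma> 0 = x0"
    "\<And>t. t \<in> ball 0 \<epsilon> \<Longrightarrow> D (\<gamma> t) \<noteq> 0"
    "\<And>i t. t \<in> ball 0 \<epsilon> \<Longrightarrow> a i (\<gamma> t) = a i x0 + (if i = p then t else 0)"
    "\<And>f t. f \<in> polyfun coordsV \<Longrightarrow> t \<in> ball 0 \<epsilon> \<Longrightarrow>
      ((\<lambda>t. f (\<gamma> t)) has_field_derivative
        bdot (tangent p (\<gamma> t)) (gradient f (\<gamma> t)) / (D (\<gamma> t))\<^sup>2) (at t)"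
proof -
  define F where "F x = (\<chi> i. a i x)" for x
  define F' where "F' x = Blinfun ((*v) (jac x))" for x
  have F'_apply: "blinfun_apply (F' x) = (*v) (jac x)" for x
    unfolding F'_def by (rule bounded_linear_Blinfun_apply[OF bounded_linear_matrix_vector_mult])
  define U where "U = {x. D x \<noteq> 0}"
  have contD: "continuous_on UNIV D" by (rule continuous_on_polyfun[OF polyfun_D])
  have "open U"
    unfolding U_def by (intro open_Collect_neq contD continuous_on_const)
  have derF: "(F has_derivative blinfun_apply (F' x)) (at x)" for x
  proof -
    have "(F has_derivative (\<lambda>h. \<chi> i. bdot (gradient (a i) x) h)) (at x)"
      unfolding F_def by (intro has_derivative_vec_lambda polyfun_has_derivative a_poly)
    also have "(\<lambda>h. \<chi> i. bdot (gradient (a i) x) h) = (*v) (jac x)"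
      by (auto simp: fun_eq_iff vec_eq_iff jac_mult_component)
    finally show ?thesis by (simp add: F'_apply)
  qed
  have contF': "continuous_on U F'"
  proof (rule continuous_on_blinfun_componentwise)
    fix b :: "complex^'n"
    have "continuous_on U (\<lambda>x. jac x $ i $ j)" for i j
      by (intro continuous_on_polyfun polyfun_jac)
    then show "continuous_on U (\<lambda>x. blinfun_apply (F' x) b)"
      unfolding F'_apply matrix_vector_mult_def
      by (intro continuous_on_vec_lambda continuous_on_sum continuous_on_mult continuous_on_const) auto
  qed
  have "x0 \<in> U" by (simp add: U_def D_base)
  \<comment> \<open>A left inverse of the Jacobian at \<open>x0\<close> is the form of invertibility
    that the inverse function theorem asks for.\<close>
  obtain M where M: "M ** jac x0 = mat 1"
    using D_base invertible_det_nz[of "jac x0"] invertible_left_inverse[of "jac x0"]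
    by (auto simp: D_def)
  have "Blinfun ((*v) M) o\<^sub>L F' x0 = id_blinfun"
    by (rule blinfun_eqI)
       (simp add: F'_apply bounded_linear_Blinfun_apply[OF bounded_linear_matrix_vector_mult]
          matrix_vector_mul_assoc M)
  from inverse_function_theorem[OF \<open>open U\<close> derF contF' \<open>x0 \<in> U\<close> this]
  obtain U' V g g' where IFT: "open U'" "U' \<subseteq> U" "x0 \<in> U'" "open V" "F x0 \<in> V"
      "homeomorphism U' V F g"
      "\<And>y. y \<in> V \<Longrightarrow> (g has_derivative (g' y)) (at y)"
      "\<And>y. y \<in> V \<Longrightarrow> g' y = inv (blinfun_apply (F' (g y)))"
      "\<And>y. y \<in> V \<Longrightarrow> bij (blinfun_apply (F' (g y)))"
    by metis
  let ?l = "\<lambda>t::complex. t *s (axis p 1 :: complex^'n)"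
  have bl: "bounded_linear ?l"
    by (intro linear_conv_bounded_linear[THEN iffD1] linearI)
       (auto simp: vec_eq_iff ring_distribs)
  have contl: "continuous_on UNIV (\<lambda>t. F x0 + ?l t)"
    by (intro continuous_intros linear_continuous_on bl)
  have "open ((\<lambda>t. F x0 + ?l t) -` V)"
    by (rule open_vimage[OF IFT(4) contl])
  moreover have "0 \<in> (\<lambda>t. F x0 + ?l t) -` V" using IFT(5) by simp
  ultimately obtain \<epsilon> where \<epsilon>: "\<epsilon> > 0" "ball 0 \<epsilon> \<subseteq> (\<lambda>t. F x0 + ?l t) -` V"
    using open_contains_ball by blast
  define \<gamma> where "\<gamma> t = g (F x0 + ?l t)" for t
  have inV: "F x0 + ?l t \<in> V" if "t \<in> ball 0 \<epsilon>" for t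
    using \<epsilon>(2) that by auto
  have \<gamma>U: "\<gamma> t \<in> U" and F\<gamma>: "F (\<gamma> t) = F x0 + ?l t" if "t \<in> ball 0 \<epsilon>" for t
    using IFT(2,6) inV[OF that] unfolding \<gamma>_def homeomorphism_def by auto
  \<comment> \<open>The derivative of the local inverse is the inverse Jacobian, and
    \<open>jac_tangent\<close> exhibits the preimage of the axis \<open>p\<close>: it is
    \<open>tangent p\<close> divided by the square of \<open>D\<close>.\<close>
  have der\<gamma>: "(\<gamma> has_derivative (\<lambda>h. h *s ((1 / (D (\<gamma> t))\<^sup>2) *s tangent p (\<gamma> t)))) (at t)"
    if t: "t \<in> ball 0 \<epsilon>" for t
  proof -
    let ?v = "(1 / (D (\<gamma> t))\<^sup>2) *s tangent p (\<gamma> t)"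
    have "((\<lambda>t. F x0 + ?l t) has_derivative ?l) (at t)"
      by (auto intro!: derivative_eq_intros bounded_linear_imp_has_derivative bl)
    from has_derivative_compose[OF this IFT(7)[OF inV[OF t]]]
    have "(\<gamma> has_derivative (\<lambda>h. g' (F x0 + ?l t) (?l h))) (at t)"
      by (simp add: \<gamma>_def[abs_def])
    moreover have "g' (F x0 + ?l t) (?l h) = h *s ?v" for h
    proof -
      have bij: "bij ((*v) (jac (\<gamma> t)))"
        using IFT(9)[OF inV[OF t]] by (simp add: F'_apply \<gamma>_def)
      have "jac (\<gamma> t) *v (h *s ?v) = ?l h"
        using \<gamma>U[OF t] by (simp add: vec.scale jac_tangent U_def)
      then have "inv ((*v) (jac (\<gamma> t))) (?l h) = h *s ?v"
        using bij by (metis bij_inv_eq_iff)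
      then show ?thesis
        using IFT(8)[OF inV[OF t]] by (simp add: F'_apply \<gamma>_def)
    qed
    ultimately show ?thesis by simp
  qed
  show thesis
  proof (rule that[of \<epsilon> \<gamma>])
    show "\<epsilon> > 0" by (fact \<epsilon>)
    show "\<gamma> 0 = x0"
      using IFT(3,6) by (simp add: \<gamma>_def homeomorphism_def)
    show "D (\<gamma> t) \<noteq> 0" if "t \<in> ball 0 \<epsilon>" for t
      using \<gamma>U[OF that] by (simp add: U_def)
    show "a i (\<gamma> t) = a i x0 + (if i = p then t else 0)" if "t \<in> ball 0 \<epsilon>" for i t
      using arg_cong[OF F\<gamma>[OF that], of "\<lambda>v. v $ i"] by (simp add: F_def axis_def)
    show "((\<lambda>t. f (\<gamma> t)) has_field_derivative
        bdot (tangent p (\<gamma> t)) (gradient f (\<gamma> t)) / (D (\<gamma> t))\<^sup>2) (at t)"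
      if f: "f \<in> polyfun coordsV" and t: "t \<in> ball 0 \<epsilon>" for f t
    proof -
      have "((\<lambda>t. f (\<gamma> t)) has_derivative (\<lambda>h. bdot (gradient f (\<gamma> t))
          (h *s ((1 / (D (\<gamma> t))\<^sup>2) *s tangent p (\<gamma> t))))) (at t)"
        by (rule has_derivative_compose[OF der\<gamma>[OF t] polyfun_has_derivative[OF f]])
      \<comment> \<open>The derivative is multiplication by a complex number, so real
        differentiability becomes complex differentiability.\<close>
      then show ?thesis
        by (rule has_derivative_imp_has_field_derivative)
           (simp add: bdot_scale_right bdot_commute)
    qed
  qed
qed

end

text \<open>If \<open>f\<close> is nonzero somewhere, then \<open>g\<close> vanishes on a nonempty
  open set, and the identity theorem spreads this over the connected \<open>S\<close>.\<close>

lemma holomorphic_mult_eq_0_cases: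
  assumes "f holomorphic_on S" "g holomorphic_on S" "open S" "connected S"
    and zero: "\<And>t. t \<in> S \<Longrightarrow> f t * g t = 0"
  shows "(\<forall>t\<in>S. f t = 0) \<or> (\<forall>t\<in>S. g t = 0)"
proof (cases "\<forall>t\<in>S. f t = 0")
  case False
  then obtain s where s: "s \<in> S" "f s \<noteq> 0" by blast
  let ?T = "{t \<in> S. f t \<noteq> 0}"
  have "open (S \<inter> f -` (- {0}))"
    using assms(1,3) holomorphic_on_imp_continuous_on continuous_open_preimage
    by (metis open_Compl closed_singleton)
  moreover have "S \<inter> f -` (- {0}) = ?T" by auto
  ultimately have "open ?T" by simp
  have "g t = 0" if "t \<in> S" for t
  proof (rule analytic_continuation_open[of ?T S g "\<lambda>_. 0"])
    show "?T \<noteq> {}" using s by blast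
    show "g z = 0" if "z \<in> ?T" for z using zero[of z] that by auto
  qed (use \<open>open ?T\<close> assms that in auto)
  then show ?thesis by blast
qed simp

context adapted_frame
begin

text \<open>If \<open>f (\<gamma> t)\<close> were nonconstant in \<open>t\<close>, it would have a
  zero of finite order at \<open>0\<close> and factor there as a power of \<open>t\<close> times a
  nonvanishing holomorphic function. The induction \<open>order\<close> excludes such a
  factor.\<close>

lemma vanishing_along_arc:
  assumes p: "p \<notin> J" and "\<epsilon> > 0" and \<gamma>0: "\<gamma> 0 = x0"
    and D\<gamma>: "\<And>t. t \<in> ball 0 \<epsilon> \<Longrightarrow> D (\<gamma> t) \<noteq> 0"
    and deriv: "\<And>f t. f \<in> polyfun coordsV \<Longrightarrow> t \<in> ball 0 \<epsilon> \<Longrightarrow>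
      ((\<lambda>t. f (\<gamma> t)) has_field_derivative
        bdot (tangent p (\<gamma> t)) (gradient f (\<gamma> t)) / (D (\<gamma> t))\<^sup>2) (at t)"
    and f: "f \<in> vanishing_ideal coordsV X" and t: "t \<in> ball 0 \<epsilon>"
  shows "f (\<gamma> t) = 0"
proof -
  have hol: "(\<lambda>t. f (\<gamma> t)) holomorphic_on ball 0 \<epsilon>" if "f \<in> polyfun coordsV" for f
    unfolding holomorphic_on_open[OF open_ball] using deriv[OF that] by blast
  \<comment> \<open>Differentiating along \<open>tangent p\<close> stays in the ideal but lowers the order of vanishing at
    \<open>0\<close>, so no member of the ideal can vanish to finite order.\<close>
  have order: "g 0 = 0"
    if "f \<in> vanishing_ideal coordsV X" "0 < r" "r \<le> \<epsilon>" "g holomorphic_on ball 0 r"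
      "\<And>w. w \<in> ball 0 r \<Longrightarrow> f (\<gamma> w) = w ^ n * g w" for n f g r
    using that
  proof (induction n arbitrary: f g)
    case 0
    have "f x0 = 0" using 0(1) base by (simp add: vanishing_ideal_def)
    with 0(2) 0(5)[of 0] show ?case by (simp add: \<gamma>0)
  next
    case (Suc n)
    have f_poly: "f \<in> polyfun coordsV" using Suc.prems by (simp add: vanishing_ideal_def)
    let ?k = "\<lambda>x. bdot (tangent p x) (gradient f x)"
    \<comment> \<open>This is the cofactor left after differentiating \<open>w ^ Suc n * g w\<close>
      and clearing the denominator. At \<open>0\<close> it equals the square of \<open>D x0\<close>
      times \<open>of_nat (Suc n) * g 0\<close>, so its vanishing forces
      \<open>g 0 = 0\<close>.\<close>
    let ?g = "\<lambda>w. (D (\<gamma> w))\<^sup>2 * (of_nat (Suc n) * g w + w * deriv g w)"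
    have "?k (\<gamma> w) = w ^ n * ?g w" if w: "w \<in> ball 0 r" for w
    proof -
      have w\<epsilon>: "w \<in> ball 0 \<epsilon>" using w Suc.prems(3) by auto
      have "(g has_field_derivative deriv g w) (at w)"
        using Suc.prems(4) w holomorphic_derivI open_ball by blast
      then have "((\<lambda>w. w ^ Suc n * g w) has_field_derivative
          (of_nat (Suc n) * w ^ n * g w + w ^ Suc n * deriv g w)) (at w)"
        by (auto intro!: derivative_eq_intros simp: algebra_simps simp del: power_Suc)
      then have "((\<lambda>w. f (\<gamma> w)) has_field_derivative
          (of_nat (Suc n) * w ^ n * g w + w ^ Suc n * deriv g w)) (at w)"
        by (rule has_field_derivative_transform_within_open[OF _ open_ball w])
           (simp only: Suc.prems(5))
      from DERIV_unique[OF this deriv[OF f_poly w\<epsilon>]]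
      have "?k (\<gamma> w) = (D (\<gamma> w))\<^sup>2 * (of_nat (Suc n) * w ^ n * g w + w ^ Suc n * deriv g w)"
        using D\<gamma>[OF w\<epsilon>] by (simp add: field_simps)
      then show ?thesis by (simp add: algebra_simps)
    qed
    moreover have "?g holomorphic_on ball 0 r"
    proof -
      have "(\<lambda>w. D (\<gamma> w)) holomorphic_on ball 0 r"
        using hol[OF polyfun_D] Suc.prems(3) by (auto elim: holomorphic_on_subset)
      then show ?thesis
        using Suc.prems(4) by (intro holomorphic_intros holomorphic_deriv) auto
    qed
    ultimately have "?g 0 = 0"
      using Suc.IH[of ?k ?g] vanishing_ideal_tangent[OF Suc.prems(1) p] Suc.prems(2,3) by blast
    then have "of_nat (Suc n) * g 0 = 0"
      using D_base by (simp only: \<gamma>0 mult_eq_0_iff power_eq_0_iff mult_zero_left add_0_right) auto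
    then show "g 0 = 0" by (simp only: mult_eq_0_iff of_nat_eq_0_iff) auto
  qed
  let ?h = "\<lambda>t. f (\<gamma> t)"
  have f_poly: "f \<in> polyfun coordsV" using f by (simp add: vanishing_ideal_def)
  have h0: "?h 0 = 0" using f base by (simp add: \<gamma>0 vanishing_ideal_def)
  have "?h constant_on ball 0 \<epsilon>"
  proof (rule ccontr)
    assume nonconst: "\<not> ?h constant_on ball 0 \<epsilon>"
    have z: "0 \<in> ball 0 \<epsilon>" using \<open>\<epsilon> > 0\<close> by simp
    show False
    proof (rule holomorphic_factor_zero_nonconstant[OF hol[OF f_poly] open_ball connected_ball z h0
            nonconst])
      fix g :: "complex \<Rightarrow> complex" and r :: real and n :: nat
      assume r: "0 < r" "ball (0::complex) r \<subseteq> ball 0 \<epsilon>"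
        and g: "g holomorphic_on ball 0 r" "\<And>w. w \<in> ball 0 r \<Longrightarrow> ?h w = (w - 0) ^ n * g w"
          "\<And>w. w \<in> ball 0 r \<Longrightarrow> g w \<noteq> 0"
      have "r \<le> \<epsilon>" using r by (simp add: ball_subset_ball_iff)
      then have "g 0 = 0"
        using g(2) by (intro order[OF f r(1) _ g(1), of n]) simp_all
      then show False using g(3)[of 0] r(1) by simp
    qed
  qed
  then show ?thesis
    using h0 t \<open>\<epsilon> > 0\<close> unfolding constant_on_def by force
qed

text \<open>Since \<open>X\<close> is closed, vanishing of its whole ideal along the arc places the
  arc in \<open>X\<close>. Products of polynomials pull back to products of holomorphic functions on
  a disc, which makes the closure irreducible.\<close>

lemma arc_in_variety:
  assumes p: "p \<notin> J"
  obtains \<epsilon> \<gamma> where "\<epsilon> > 0" "\<gamma> 0 = x0" "\<gamma> ` ball 0 \<epsilon> \<subseteq> X"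
    "\<And>t. t \<in> ball 0 \<epsilon> \<Longrightarrow> D (\<gamma> t) \<noteq> 0"
    "\<And>i t. t \<in> ball 0 \<epsilon> \<Longrightarrow> a i (\<gamma> t) = a i x0 + (if i = p then t else 0)"
    "\<And>f t. f \<in> polyfun coordsV \<Longrightarrow> t \<in> ball 0 \<epsilon> \<Longrightarrow>
      ((\<lambda>t. f (\<gamma> t)) has_field_derivative
        bdot (tangent p (\<gamma> t)) (gradient f (\<gamma> t)) / (D (\<gamma> t))\<^sup>2) (at t)"
    "zariski_irreducible coordsV (zariski_closure coordsV (\<gamma> ` ball 0 \<epsilon>))"
    "{x0} \<subset> zariski_closure coordsV (\<gamma> ` ball 0 \<epsilon>)"
proof (rule arc_exists[where p = p])
  fix \<epsilon> \<gamma>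
  assume arc: "\<epsilon> > 0" "\<gamma> 0 = x0"
    "\<And>t. t \<in> ball 0 \<epsilon> \<Longrightarrow> D (\<gamma> t) \<noteq> 0"
    "\<And>i t. t \<in> ball 0 \<epsilon> \<Longrightarrow> a i (\<gamma> t) = a i x0 + (if i = p then t else 0)"
    "\<And>f t. f \<in> polyfun coordsV \<Longrightarrow> t \<in> ball 0 \<epsilon> \<Longrightarrow>
      ((\<lambda>t. f (\<gamma> t)) has_field_derivative
        bdot (tangent p (\<gamma> t)) (gradient f (\<gamma> t)) / (D (\<gamma> t))\<^sup>2) (at t)"
  let ?S = "\<gamma> ` ball 0 \<epsilon>"
  have inX: "?S \<subseteq> X"
    using zero_set_vanishing_ideal[OF closed] vanishing_along_arc[OF p arc(1,2,3,5)] by blast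
  have hol: "(\<lambda>t. f (\<gamma> t)) holomorphic_on ball 0 \<epsilon>" if "f \<in> polyfun coordsV" for f
    unfolding holomorphic_on_open[OF open_ball] using arc(5)[OF that] by blast
  have irr: "zariski_irreducible coordsV (zariski_closure coordsV ?S)"
  proof (rule zariski_irreducible_closure)
    show "?S \<noteq> {}" using arc(1) by simp
    fix f g :: "complex^'n \<Rightarrow> complex"
    assume "f \<in> polyfun coordsV" "g \<in> polyfun coordsV" "\<forall>x\<in>?S. f x * g x = 0"
    then show "(\<forall>x\<in>?S. f x = 0) \<or> (\<forall>x\<in>?S. g x = 0)"
      using holomorphic_mult_eq_0_cases[OF hol hol open_ball connected_ball, of f g] by auto
  qed
  \<comment> \<open>The coordinate \<open>a p\<close> separates the point with parameter
    \<open>\<epsilon> / 2\<close> from \<open>x0\<close>, so the closure has more than one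
    point.\<close>
  have half: "complex_of_real (\<epsilon> / 2) \<in> ball 0 \<epsilon>" using arc(1) by simp
  have "\<gamma> (complex_of_real (\<epsilon> / 2)) \<noteq> x0"
    using arc(4)[OF half, of p] arc(1) by auto
  moreover have "x0 \<in> ?S" "\<gamma> (complex_of_real (\<epsilon> / 2)) \<in> ?S"
    using arc(1,2) half by (force, blast)
  ultimately have "{x0} \<subset> zariski_closure coordsV ?S"
    using zariski_closure_superset[of ?S coordsV] by blast
  with that[OF arc(1,2) inX arc(3,4,5) irr] show thesis by blast
qed

section \<open>The rank of a frame on a curve\<close>

text \<open>With every index in \<open>J\<close>, the matrix of first-order coefficients annihilates
  \<open>x - x0\<close> for all \<open>x\<close> in \<open>X\<close>, so its determinant can be
  nonzero on \<open>X\<close> only at \<open>x0\<close>. Irreducibility then shrinks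
  \<open>X\<close> to a point, contrary to dimension one.\<close>

lemma frame_not_full:
  assumes "irreducible_curve X"
  shows "J \<noteq> UNIV"
proof
  assume J: "J = UNIV"
  have "\<forall>i. \<exists>B. (\<forall>j. (\<lambda>x. B x $ j) \<in> polyfun coordsV) \<and> B x0 = gradient (a i) x0 \<and>
      (\<forall>x. a i x - a i x0 = bdot (B x) (x - x0))"
    using polyfun_taylor_ex[OF a_poly] by blast
  then obtain B where B: "\<And>i j. (\<lambda>x. B i x $ j) \<in> polyfun coordsV"
      "\<And>i. B i x0 = gradient (a i) x0" "\<And>i x. a i x - a i x0 = bdot (B i x) (x - x0)"
    by metis
  let ?M = "\<lambda>x. \<chi> i. B i x"
  have poly: "(\<lambda>x. det (?M x)) \<in> polyfun coordsV"
    by (rule polyfun_det) (simp add: B)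
  have "x = x0" if "x \<in> X" "det (?M x) \<noteq> 0" for x
  proof -
    have "bdot (B i x) (x - x0) = 0" for i
      using a_vanish[of i x] a_vanish[of i x0] that(1) base by (simp add: J flip: B(3))
    then have "?M x *v (x - x0) = 0"
      by (simp add: vec_eq_iff matrix_vector_mult_def bdot_def)
    then have "x - x0 = 0"
      using that(2) invertible_det_nz[of "?M x"] invertible_left_inverse[of "?M x"]
        matrix_left_invertible_ker[of "?M x"] by blast
    then show ?thesis by simp
  qed
  then have "X \<subseteq> {x0} \<union> {x. det (?M x) = 0}" by blast
  then have "X \<subseteq> {x0} \<or> X \<subseteq> {x. det (?M x) = 0}"
    using assms zariski_closed_singleton zariski_closed_level[OF poly]
    by (intro zariski_irreducible_subset_Un[of coordsV]) (auto simp: irreducible_curve_def)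
  \<comment> \<open>At \<open>x0\<close> the coefficients are the gradients, so nondegeneracy of the
    frame rules out the second alternative.\<close>
  moreover have "det (?M x0) \<noteq> 0" using nondegenerate by (simp add: B)
  ultimately have "X \<subseteq> {x0}" using base by blast
  moreover obtain S T where ST: "zariski_irreducible coordsV S" "S \<subset> T" "T \<subseteq> X"
    using assms unfolding irreducible_curve_def dim_ge_1_iff by blast
  ultimately have "S = {}" by blast
  with ST(1) show False by (simp add: zariski_irreducible_def)
qed

text \<open>Two spare indices \<open>p\<close> and \<open>q\<close> conflict: the arc in direction
  \<open>p\<close> is dense in \<open>X\<close> and keeps \<open>a q\<close> fixed, whereas the arc
  in direction \<open>q\<close> moves \<open>a q\<close> inside \<open>X\<close>.\<close>

lemma frame_corank_1:
  assumes curve: "irreducible_curve X" and p: "p \<notin> J"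
  shows "J = UNIV - {p}"
proof (rule ccontr)
  assume "J \<noteq> UNIV - {p}"
  with p obtain q where q: "q \<notin> J" "q \<noteq> p" by blast
  obtain \<epsilon> \<gamma> where arc: "\<epsilon> > 0" "\<gamma> ` ball 0 \<epsilon> \<subseteq> X"
    "\<And>i t. t \<in> ball 0 \<epsilon> \<Longrightarrow> a i (\<gamma> t) = a i x0 + (if i = p then t else 0)"
    "zariski_irreducible coordsV (zariski_closure coordsV (\<gamma> ` ball 0 \<epsilon>))"
    "{x0} \<subset> zariski_closure coordsV (\<gamma> ` ball 0 \<epsilon>)"
    by (rule arc_in_variety[OF p]) blast
  have "zariski_closure coordsV (\<gamma> ` ball 0 \<epsilon>) = X"
    using irreducible_curve_closed_subset_eq[OF curve zariski_irreducible_singleton arc(4,5)]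
      zariski_closure_minimal[OF closed arc(2)] by blast
  moreover have "zariski_closure coordsV (\<gamma> ` ball 0 \<epsilon>) \<subseteq> {x. a q x = a q x0}"
    using arc(3) q(2)
    by (intro zariski_closure_minimal zariski_closed_level a_poly) auto
  ultimately have const: "a q x = a q x0" if "x \<in> X" for x using that by blast
  obtain \<delta> \<beta> where arc': "\<delta> > 0" "\<beta> ` ball 0 \<delta> \<subseteq> X"
    "\<And>i t. t \<in> ball 0 \<delta> \<Longrightarrow> a i (\<beta> t) = a i x0 + (if i = q then t else 0)"
    by (rule arc_in_variety[OF q(1)]) blast
  have half: "complex_of_real (\<delta> / 2) \<in> ball 0 \<delta>" using arc'(1) by simp
  then have "\<beta> (complex_of_real (\<delta> / 2)) \<in> X" using arc'(2) by blast
  from const[OF this] arc'(3)[OF half, of q] arc'(1) show False by simp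
qed

text \<open>On a curve \<open>J\<close> misses exactly one index, so the normal space has
  codimension one wherever \<open>D\<close> is nonzero, as the Jacobian criterion demands. This
  makes the points of the arcs in \<open>X\<close> regular.\<close>

lemma regular_if_nondegenerate:
  assumes curve: "irreducible_curve X" and "x \<in> X" "D x \<noteq> 0"
  shows "x \<in> regular_points X"
proof -
  obtain p where "p \<notin> J" using frame_not_full[OF curve] by blast
  from frame_corank_1[OF curve this] have "card J = CARD('n) - 1"
    by (simp add: card_Diff_singleton)
  then show ?thesis
    using normal_space_spanned(2)[OF assms(2,3)] assms(2)
    by (simp add: regular_points_def alg_dim_irreducible_curve[OF curve])
qed

end

section \<open>Construction of an adapted frame\<close>

lemma adapted_frame_exists:
  fixes X :: "(complex^'n) set"
  assumes "zariski_closed coordsV X" "X \<noteq> {}"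
  shows "\<exists>a J x0. adapted_frame X a J x0"
proof -
  obtain y where "y \<in> X" using assms(2) by blast
  \<comment> \<open>The bound on the ranks guarantees that a point of maximal rank exists.\<close>
  moreover have "\<forall>x. x \<in> X \<longrightarrow> vec.dim (normal_space_at X x) < Suc CARD('n)"
    by (metis vec.dim_subset subset_UNIV vec_dim_card le_imp_less_Suc)
  ultimately have "\<exists>x. x \<in> X \<and> (\<forall>y. y \<in> X \<longrightarrow>
      vec.dim (normal_space_at X y) \<le> vec.dim (normal_space_at X x))"
    by (rule ex_has_greatest_nat)
  then obtain x0 where x0: "x0 \<in> X"
      "\<And>y. y \<in> X \<Longrightarrow> vec.dim (normal_space_at X y) \<le> vec.dim (normal_space_at X x0)"
    by blast
  let ?G = "(\<lambda>f. gradient f x0) ` vanishing_ideal coordsV X"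
  \<comment> \<open>The basis is drawn from the gradients themselves rather than from their span, so
    that each basis vector lifts to a polynomial in the ideal.\<close>
  obtain B where B: "B \<subseteq> ?G" "vec.independent B" "card B = vec.dim ?G"
    using vec.basis_exists[of ?G] by metis
  obtain B' where B': "B \<subseteq> B'" "vec.independent B'" "UNIV \<subseteq> vec.span B'"
    using vec.maximal_independent_subset_extend[OF subset_UNIV B(2)] by metis
  have "card B' = CARD('n)"
    using vec.dim_unique[OF subset_UNIV B'(3,2) refl] unfolding vec_dim_card by simp
  moreover have "finite B'" by (rule vec.finiteI_independent[OF B'(2)])
  ultimately obtain \<beta> where \<beta>: "bij_betw \<beta> (UNIV :: 'n set) B'"
    using finite_same_card_bij[of "UNIV :: 'n set" B'] by auto
  \<comment> \<open>Indices in \<open>J\<close> label the gradients coming from the ideal; the basis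
    vectors added to fill up the space will become linear forms.\<close>
  define J where "J = {i. \<beta> i \<in> B}"
  have "bij_betw \<beta> J B"
    using \<beta> B'(1) by (auto simp: bij_betw_def J_def inj_on_def)
  then have card: "card J = vec.dim (normal_space_at X x0)"
    using B(3) bij_betw_same_card[of \<beta> J B] by (simp add: normal_space_at_def)
  have "\<forall>b\<in>B. \<exists>f. f \<in> vanishing_ideal coordsV X \<and> gradient f x0 = b"
    using B(1) by blast
  then obtain \<phi> where \<phi>: "\<And>b. b \<in> B \<Longrightarrow> \<phi> b \<in> vanishing_ideal coordsV X"
      "\<And>b. b \<in> B \<Longrightarrow> gradient (\<phi> b) x0 = b"
    by metis
  define a where "a i = (if i \<in> J then \<phi> (\<beta> i) else (\<lambda>x. bdot (\<beta> i) x + 0))" for i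
  have grad: "gradient (a i) x0 = \<beta> i" for i
    using gradient_bdot[of "\<beta> i" 0 x0] \<phi>(2)[of "\<beta> i"] by (simp add: a_def J_def)
  have "adapted_frame X a J x0"
  proof
    show "a i \<in> polyfun coordsV" for i
      using \<phi>(1)[of "\<beta> i"] polyfun_bdot_affine[of "\<beta> i" 0]
      by (auto simp: a_def J_def vanishing_ideal_def)
    show "a i x = 0" if "i \<in> J" "x \<in> X" for i x
      using that \<phi>(1)[of "\<beta> i"] by (auto simp: a_def J_def vanishing_ideal_def)
    show "det (\<chi> i. gradient (a i) x0) \<noteq> 0"
    proof (rule det_nonzero_if_kernel_trivial)
      fix h assume h: "(\<chi> i. gradient (a i) x0) *v h = 0"
      \<comment> \<open>A kernel vector is orthogonal to a basis, hence to everything, and testing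
        against the axes shows that it is zero. Isotropic vectors do no harm, since the argument
        rests on nondegeneracy of \<open>bdot\<close> alone.\<close>
      have "bdot h b = 0" if b: "b \<in> B'" for b
      proof -
        obtain i where "b = \<beta> i" using \<beta> b by (auto simp: bij_betw_def)
        then show ?thesis
          using arg_cong[OF h, of "\<lambda>v. v $ i"]
          by (simp add: grad matrix_vector_mult_def bdot_def mult.commute)
      qed
      then have "bdot h y = 0" for y
        using bdot_span_eq_0[of y B' h] B'(3) by blast
      then show "h = 0"
        unfolding vec_eq_iff zero_index by (metis bdot_axis bdot_commute)
    qed
  qed (use assms x0 card in auto)
  then show ?thesis by blast
qed

section \<open>The ED correspondence of a curve\<close>

lemma zariski_closed_ED_fiber: "zariski_closed coordsV (ED_fiber X u)"
proof -
  have "ED_fiber X u = (\<lambda>x. (x, u)) -` ED_corr X" by (auto simp: ED_fiber_def)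
  moreover have "zariski_closed coordsV ((\<lambda>x. (x, u)) -` ED_corr X)"
    unfolding ED_corr_def
    by (rule zariski_closed_vimage[OF zariski_closed_closure])
       (auto simp: coordsP_def intro: pf_const polyfun_component)
  ultimately show ?thesis by simp
qed

text \<open>The cylinder over \<open>X\<close> is closed and contains the normal pairs over regular
  points, so taking the closure adds no first components outside \<open>X\<close>.\<close>

lemma ED_fiber_subset:
  assumes "zariski_closed coordsV X"
  shows "ED_fiber X u \<subseteq> X"
proof -
  have "zariski_closed coordsP (fst -` X)"
    by (rule zariski_closed_vimage[OF assms])
       (auto simp: coordsV_def intro: polyfun_fst_component)
  then have "ED_corr X \<subseteq> fst -` X"
    unfolding ED_corr_def by (rule zariski_closure_minimal) (auto simp: regular_points_def)
  then show ?thesis by (auto simp: ED_fiber_def)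
qed

text \<open>A fiber of positive dimension contains an irreducible set with a proper irreducible
  subset; inside the curve such a set must be all of \<open>X\<close>.\<close>

lemma Sigma_inf_curve_iff:
  assumes curve: "irreducible_curve X"
  shows "u \<in> Sigma_inf X \<longleftrightarrow> X \<subseteq> ED_fiber X u"
proof
  have closed: "zariski_closed coordsV X"
    using curve by (simp add: irreducible_curve_def zariski_irreducible_def)
  assume "u \<in> Sigma_inf X"
  then obtain A B where AB: "zariski_irreducible coordsV A" "zariski_irreducible coordsV B"
      "A \<subset> B" "B \<subseteq> ED_fiber X u"
    unfolding Sigma_inf_def mem_Collect_eq dim_ge_1_iff by blast
  then have "B = X"
    using irreducible_curve_closed_subset_eq[OF curve AB(1-3)] ED_fiber_subset[OF closed] by blast
  with AB(4) show "X \<subseteq> ED_fiber X u" by simp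
next
  assume "X \<subseteq> ED_fiber X u"
  then show "u \<in> Sigma_inf X"
    using curve dim_ge_mono[of coordsV X 1] by (simp add: Sigma_inf_def irreducible_curve_def)
qed

text \<open>Because \<open>tangent p\<close> is a polynomial field, the condition is polynomial in
  \<open>x\<close> and \<open>u\<close> jointly. It holds on the normal pairs over regular points
  and therefore survives the Zariski closure.\<close>

lemma (in adapted_frame) ED_corr_orthogonal_tangent:
  assumes "(x, u) \<in> ED_corr X" "p \<notin> J"
  shows "bdot (tangent p x) (u - x) = 0"
proof -
  let ?P = "\<lambda>z. bdot (tangent p (fst z)) (snd z - fst z)"
  have "(\<lambda>z. tangent p (fst z) $ i) \<in> polyfun coordsP" for i
    by (rule polyfun_compose[OF polyfun_tangent])
       (auto simp: coordsV_def intro: polyfun_fst_component)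
  moreover have "(\<lambda>z. (snd z - fst z) $ i) \<in> polyfun coordsP" for i :: 'n
    using polyfun_diff[OF polyfun_snd_component polyfun_fst_component, of i i] by simp
  ultimately have "?P \<in> polyfun coordsP"
    by (rule polyfun_bdot)
  then have "zariski_closed coordsP {z. ?P z = 0}" by (rule zariski_closed_level)
  then have "ED_corr X \<subseteq> {z. ?P z = 0}"
    unfolding ED_corr_def
    by (rule zariski_closure_minimal)
       (use tangent_orthogonal assms(2) in \<open>auto simp: regular_points_def\<close>)
  with assms(1) show ?thesis by auto
qed

text \<open>The sphere equation belongs to the ideal and has gradient \<open>2 *s (x - u)\<close>;
  minus one half of it is the vector sought.\<close>

lemma sphere_difference_in_normal_space:
  assumes "X \<subseteq> hypersphere u r"
  shows "u - x \<in> normal_space_at X x"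
proof -
  let ?g = "\<lambda>x. bdot (x - u) (x - u) - r"
  have "?g \<in> vanishing_ideal coordsV X"
    using assms polyfun_sphere by (auto simp: vanishing_ideal_def hypersphere_def)
  then have "gradient ?g x \<in> normal_space_at X x"
    unfolding normal_space_at_def by (intro vec.span_base imageI)
  then have "(- 1 / 2) *s (2 *s (x - u)) \<in> normal_space_at X x"
    unfolding gradient_sphere normal_space_at_def by (rule vec.span_scale)
  moreover have "(- 1 / 2) *s (2 *s (x - u)) = u - x" by (simp add: vec_eq_iff)
  ultimately show ?thesis by metis
qed

proposition Sigma_inf_eq_centers:
  fixes X :: "(complex^'n) set"
  assumes curve: "irreducible_curve X"
  shows "Sigma_inf X = {u. \<exists>r. X \<subseteq> hypersphere u r}"
proof -
  have X: "zariski_closed coordsV X" "X \<noteq> {}"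
    using curve by (simp_all add: irreducible_curve_def zariski_irreducible_def)
  obtain a J x0 where "adapted_frame X a J x0"
    using adapted_frame_exists[OF X] by blast
  then interpret adapted_frame X a J x0 .
  obtain p where p: "p \<notin> J" using frame_not_full[OF curve] by blast
  show ?thesis
  proof (rule arc_in_variety[OF p])
    fix \<epsilon> :: real and \<gamma> :: "complex \<Rightarrow> complex^'n"
    let ?S = "\<gamma> ` ball 0 \<epsilon>"
    assume inX: "?S \<subseteq> X" and D\<gamma>: "\<And>t. t \<in> ball 0 \<epsilon> \<Longrightarrow> D (\<gamma> t) \<noteq> 0"
      and deriv: "\<And>f t. f \<in> polyfun coordsV \<Longrightarrow> t \<in> ball 0 \<epsilon> \<Longrightarrow>
        ((\<lambda>t. f (\<gamma> t)) has_field_derivative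
          bdot (tangent p (\<gamma> t)) (gradient f (\<gamma> t)) / (D (\<gamma> t))\<^sup>2) (at t)"
      and irr: "zariski_irreducible coordsV (zariski_closure coordsV ?S)"
      and proper: "{x0} \<subset> zariski_closure coordsV ?S"
    have dense: "zariski_closure coordsV ?S = X"
      by (rule irreducible_curve_closed_subset_eq[OF curve zariski_irreducible_singleton irr proper
            zariski_closure_minimal[OF X(1) inX]])
    have "\<exists>r. X \<subseteq> hypersphere u r" if "u \<in> Sigma_inf X" for u
    proof -
      \<comment> \<open>Subtracting \<open>0\<close> keeps the shape of a sphere equation, so that
        \<open>polyfun_sphere\<close> and \<open>gradient_sphere\<close> apply.\<close>
      let ?g = "\<lambda>x. bdot (x - u) (x - u) - 0"
      have "((\<lambda>t. ?g (\<gamma> t)) has_field_derivative 0) (at t within ball 0 \<epsilon>)"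
        if t: "t \<in> ball 0 \<epsilon>" for t
      proof -
        have "(\<gamma> t, u) \<in> ED_corr X"
          using \<open>u \<in> Sigma_inf X\<close> inX t
          unfolding Sigma_inf_curve_iff[OF curve] ED_fiber_def by blast
        \<comment> \<open>The velocity of the arc is proportional to \<open>tangent p\<close>, which
          is orthogonal to \<open>u - x\<close> and hence to the gradient of
          \<open>?g\<close>.\<close>
        from ED_corr_orthogonal_tangent[OF this p]
        have "bdot (tangent p (\<gamma> t)) (gradient ?g (\<gamma> t)) = 0"
          unfolding gradient_sphere bdot_scale_right by (simp add: bdot_diff_right)
        with deriv[OF polyfun_sphere t, of u 0] show ?thesis
          by (simp add: has_field_derivative_at_within)
      qed
      then obtain r where "\<And>t. t \<in> ball 0 \<epsilon> \<Longrightarrow> ?g (\<gamma> t) = r"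
        using has_field_derivative_zero_constant[OF convex_ball, of 0 \<epsilon> "\<lambda>t. ?g (\<gamma> t)"] by blast
      then have "?S \<subseteq> {x. ?g x = r}" by blast
      \<comment> \<open>A level set of a polynomial is closed, so density of the arc extends the
        constant value to all of \<open>X\<close>.\<close>
      from zariski_closure_minimal[OF zariski_closed_level[OF polyfun_sphere] this]
      have "X \<subseteq> hypersphere u r" unfolding dense by (auto simp: hypersphere_def)
      then show ?thesis by blast
    qed
    moreover have "u \<in> Sigma_inf X" if sphere: "X \<subseteq> hypersphere u r" for u r
    proof -
      have "\<gamma> t \<in> ED_fiber X u" if t: "t \<in> ball 0 \<epsilon>" for t
      proof -
        have "\<gamma> t \<in> X" using inX t by blast
        then have "\<gamma> t \<in> regular_points X"
          using regular_if_nondegenerate[OF curve] D\<gamma>[OF t] by simp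
        then show ?thesis
          unfolding ED_fiber_def ED_corr_def mem_Collect_eq
          by (intro subsetD[OF zariski_closure_superset])
             (simp add: sphere_difference_in_normal_space[OF sphere])
      qed
      then have "?S \<subseteq> ED_fiber X u" by blast
      \<comment> \<open>The fiber over \<open>u\<close> is closed as well, so it contains the
        closure of the arc, which is \<open>X\<close>.\<close>
      from zariski_closure_minimal[OF zariski_closed_ED_fiber this]
      show ?thesis by (simp add: dense Sigma_inf_curve_iff[OF curve])
    qed
    ultimately show ?thesis by blast
  qed
qed

section \<open>Affine hulls and change of center\<close>

text \<open>If \<open>bdot y\<close> is constant on \<open>X\<close>, its level set through a point
  of \<open>X\<close> is an affine subspace containing \<open>X\<close>, and hence contains the
  affine hull.\<close>

lemma normal_space_affine_hull:
  assumes "X \<noteq> {}"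
  shows "y \<in> normal_space_affine (complex_affine_hull X) \<longleftrightarrow>
    (\<forall>x\<in>X. \<forall>x'\<in>X. bdot y (x - x') = 0)"
proof
  have "X \<subseteq> complex_affine_hull X" by (auto simp: complex_affine_hull_def)
  then show "\<forall>x\<in>X. \<forall>x'\<in>X. bdot y (x - x') = 0"
    if "y \<in> normal_space_affine (complex_affine_hull X)"
    using that by (auto simp: normal_space_affine_def)
next
  assume orth: "\<forall>x\<in>X. \<forall>x'\<in>X. bdot y (x - x') = 0"
  obtain q where q: "q \<in> X" using assms by blast
  let ?V = "(\<lambda>w. q + w) ` {w. bdot y w = 0}"
  have "complex_affine ?V"
    unfolding complex_affine_def using subspace_orthogonal by blast
  moreover have "X \<subseteq> ?V"
  proof
    fix x assume "x \<in> X"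
    then have "bdot y (x - q) = 0" using orth q by blast
    moreover have "x = q + (x - q)" by simp
    ultimately show "x \<in> ?V" by blast
  qed
  ultimately have "complex_affine_hull X \<subseteq> ?V" by (auto simp: complex_affine_hull_def)
  then have "bdot y v = bdot y q" if "v \<in> complex_affine_hull X" for v
    using that by (auto simp: bdot_commute[of y] bdot_add_left)
  then show "y \<in> normal_space_affine (complex_affine_hull X)"
    by (simp add: normal_space_affine_def bdot_diff_right)
qed

text \<open>Expand the sphere equation with center \<open>c + y\<close> around \<open>c\<close>: the
  quadratic part is the constant \<open>r\<close> on \<open>X\<close>, so only the term in
  \<open>bdot y x\<close> can vary. A sphere with the new center exists exactly when that term is
  constant on \<open>X\<close>.\<close>

lemma second_center_iff:
  assumes sphere: "X \<subseteq> hypersphere c r" and "X \<noteq> {}"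
  shows "(\<exists>r'. X \<subseteq> hypersphere (c + y) r') \<longleftrightarrow>
    y \<in> normal_space_affine (complex_affine_hull X)"
proof -
  have shift: "bdot (x - (c + y)) (x - (c + y)) = r - 2 * bdot y x + 2 * bdot y c + bdot y y"
    if "x \<in> X" for x
  proof -
    have expand: "bdot (d - y) (d - y) = bdot d d - 2 * bdot y d + bdot y y" for d
      by (simp add: bdot_diff_left bdot_diff_right bdot_commute[of d y])
    have "bdot (x - c) (x - c) = r" using sphere that by (auto simp: hypersphere_def)
    then show ?thesis
      unfolding diff_diff_eq[symmetric] expand by (simp add: bdot_diff_right)
  qed
  obtain q where q: "q \<in> X" using assms(2) by blast
  have "(\<exists>r'. X \<subseteq> hypersphere (c + y) r') \<longleftrightarrow> (\<exists>s. \<forall>x\<in>X. bdot y x = s)"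
  proof
    assume "\<exists>r'. X \<subseteq> hypersphere (c + y) r'"
    then obtain r' where "\<And>x. x \<in> X \<Longrightarrow> r - 2 * bdot y x + 2 * bdot y c + bdot y y = r'"
      using shift by (auto simp: hypersphere_def subset_iff)
    then have "bdot y x = (r + 2 * bdot y c + bdot y y - r') / 2" if "x \<in> X" for x
      using that by (simp add: field_simps)
    then show "\<exists>s. \<forall>x\<in>X. bdot y x = s" by blast
  next
    assume "\<exists>s. \<forall>x\<in>X. bdot y x = s"
    then show "\<exists>r'. X \<subseteq> hypersphere (c + y) r'"
      using shift by (auto simp: hypersphere_def subset_iff)
  qed
  also have "\<dots> \<longleftrightarrow> (\<forall>x\<in>X. \<forall>x'\<in>X. bdot y (x - x') = 0)"
    using q by (auto simp: bdot_diff_right)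
  finally show ?thesis by (simp add: normal_space_affine_hull[OF assms(2)])
qed

theorem mainTheorem13:
  fixes X :: "(complex^'n) set"
  assumes "irreducible_curve X"
  shows "((\<forall>c r. \<not> X \<subseteq> hypersphere c r) \<longrightarrow> Sigma_inf X = {})
       \<and> (\<forall>c r. X \<subseteq> hypersphere c r \<longrightarrow>
            Sigma_inf X = {c + y | y. y \<in> normal_space_affine (complex_affine_hull X)})"
proof (intro conjI impI allI)
  assume "\<forall>c r. \<not> X \<subseteq> hypersphere c r"
  then show "Sigma_inf X = {}"
    unfolding Sigma_inf_eq_centers[OF assms] by blast
next
  fix c r assume sphere: "X \<subseteq> hypersphere c r"
  have "X \<noteq> {}" using assms by (simp add: irreducible_curve_def zariski_irreducible_def)
  note iff = second_center_iff[OF sphere this]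
  \<comment> \<open>Each \<open>u\<close> is written as \<open>c + (u - c)\<close>, so the criterion
    for a second center applies with displacement \<open>u - c\<close>.\<close>
  have "u \<in> Sigma_inf X \<longleftrightarrow> u - c \<in> normal_space_affine (complex_affine_hull X)" for u
    using iff[of "u - c"] by (simp add: Sigma_inf_eq_centers[OF assms])
  moreover have "u - c \<in> N \<longleftrightarrow> (\<exists>y. u = c + y \<and> y \<in> N)" for u and N :: "(complex^'n) set"
    by (metis add_diff_cancel_left' add.commute diff_add_cancel)
  ultimately show "Sigma_inf X = {c + y | y. y \<in> normal_space_affine (complex_affine_hull X)}"
    by blast
qed

end
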